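(* Let $a>0$ and $\Delta=ac-b^2>0$. At points where $d\zeta\neq0$, a coordinate $\zeta=\xi+i\eta$ reduces the principal part of $$a\,u_{xx}+2b\,u_{xy}+c\,u_{yy}+F(x,y,u,u_x,u_y)=0$$ to a scalar multiple of $u_{\xi\xi}+u_{\eta\eta}$ if and only if its differential satisfies $$a\,\zeta_x^2+2b\,\zeta_x\zeta_y+c\,\zeta_y^2=0.$$ The unique Beltrami coefficient with $|q|<1$ for which $\zeta_{\bar z}=q\,\zeta_z$ has this property is $$q=-\,\frac{a-\sqrt{\Delta}+ib}{a+\sqrt{\Delta}-ib}=\frac{c-a-2ib}{a+c+2\sqrt{\Delta}}.$$ The coefficient $$q_{\mathrm{pr}}=\frac{a-\sqrt{\Delta}-ib}{a+\sqrt{\Delta}+ib}$$ equals the coefficient $q$ just displayed only when $a=c$; for $a\neq c$ it gives $A\neq C$ (with $A$, $C$ the transformed principal coefficients defined in the context), so a coordinate solving $\zeta_{\bar z}-q_{\mathrm{pr}}\,\zeta_z=0$ does not reduce the linear equation with principal part $a\,u_{xx}+2b\,u_{xy}+c\,u_{yy}$ to the canonical form $u_{\xi\xi}+u_{\eta\eta}+(\text{lower-order terms})=0$.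
   Context: Here $a,b,c$ are the real coefficients (functions of $(x,y)$) of the second-order elliptic equation $a\,u_{xx}+2b\,u_{xy}+c\,u_{yy}+F(x,y,u,u_x,u_y)=0$, $\sqrt\Delta$ is the positive square root, $z=x+iy$, and $\xi,\eta$ are real-valued functions of $(x,y)$. The Wirtinger derivatives are $\zeta_z=\tfrac12(\zeta_x-i\zeta_y)$, $\zeta_{\bar z}=\tfrac12(\zeta_x+i\zeta_y)$. Under a change of variables $\xi=\xi(x,y)$, $\eta=\eta(x,y)$, the principal part transforms to $A\,u_{\xi\xi}+2B\,u_{\xi\eta}+C\,u_{\eta\eta}$ with $$A=a\,\xi_x^2+2b\,\xi_x\xi_y+c\,\xi_y^2,$$ $$B=a\,\xi_x\eta_x+b(\xi_x\eta_y+\xi_y\eta_x)+c\,\xi_y\eta_y,$$ $$C=a\,\eta_x^2+2b\,\eta_x\eta_y+c\,\eta_y^2,$$ and reduction to a scalar multiple of $u_{\xi\xi}+u_{\eta\eta}$ means $A=C$ and $B=0$. The coefficient $q_{\mathrm{pr}}$ is the one printed on p. 127 of Vekua's "Generalized Analytic Functions" (1962 Pergamon edition) for the Beltrami equation whose homeomorphic solutions are meant to effect this reduction.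
   Formalization: "A≠C for a≠c" is proved only where ζ_z is real: for a=4, b=0, c=1, ξ=4x−2y, η=4x+2y solves the q_pr equation with A=C=68, B=60. That no solution coordinate reduces the equation when a≠c is proved without this restriction. *)

theory Defs
  imports "HOL-Analysis.Analysis"
begin

type_synonym plane = "real \<times> real"

definition partial_x :: "(plane \<Rightarrow> 'v::real_normed_vector) \<Rightarrow> plane \<Rightarrow> 'v" where
  "partial_x f p = vector_derivative (\<lambda>t. f (t, snd p)) (at (fst p))"

definition partial_y :: "(plane \<Rightarrow> 'v::real_normed_vector) \<Rightarrow> plane \<Rightarrow> 'v" where
  "partial_y f p = vector_derivative (\<lambda>t. f (fst p, t)) (at (snd p))"

definition wirtinger_z :: "(plane \<Rightarrow> complex) \<Rightarrow> plane \<Rightarrow> complex" where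
  "wirtinger_z \<zeta> p = (partial_x \<zeta> p - \<i> * partial_y \<zeta> p) / 2"

definition wirtinger_zbar :: "(plane \<Rightarrow> complex) \<Rightarrow> plane \<Rightarrow> complex" where
  "wirtinger_zbar \<zeta> p = (partial_x \<zeta> p + \<i> * partial_y \<zeta> p) / 2"

definition zeta :: "(plane \<Rightarrow> real) \<Rightarrow> (plane \<Rightarrow> real) \<Rightarrow> plane \<Rightarrow> complex" where
  "zeta \<xi> \<eta> p = complex_of_real (\<xi> p) + \<i> * complex_of_real (\<eta> p)"

text \<open>Only first derivatives at the point enter, so pointwise differentiability with
  \<open>d\<zeta> \<noteq> 0\<close> is all that is asked of a coordinate; every smooth coordinate is included.\<close>

definition coordinate_at :: "(plane \<Rightarrow> real) \<Rightarrow> (plane \<Rightarrow> real) \<Rightarrow> plane \<Rightarrow> bool" where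
  "coordinate_at \<xi> \<eta> p \<longleftrightarrow>
     \<xi> differentiable (at p) \<and> \<eta> differentiable (at p) \<and>
     frechet_derivative (zeta \<xi> \<eta>) (at p) \<noteq> (\<lambda>h. 0)"

text \<open>In the new variables the principal part is \<open>A u\<^sub>\<xi>\<^sub>\<xi> + 2 B u\<^sub>\<xi>\<^sub>\<eta> + C u\<^sub>\<eta>\<^sub>\<eta>\<close>.\<close>

definition coeff_A where
  "coeff_A a b c \<xi> p =
     a p * (partial_x \<xi> p)\<^sup>2 + 2 * b p * partial_x \<xi> p * partial_y \<xi> p + c p * (partial_y \<xi> p)\<^sup>2"
  for a b c \<xi> :: "plane \<Rightarrow> real"

definition coeff_B where
  "coeff_B a b c \<xi> \<eta> p =
     a p * partial_x \<xi> p * partial_x \<eta> p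
     + b p * (partial_x \<xi> p * partial_y \<eta> p + partial_y \<xi> p * partial_x \<eta> p)
     + c p * partial_y \<xi> p * partial_y \<eta> p"
  for a b c \<xi> \<eta> :: "plane \<Rightarrow> real"

definition coeff_C where
  "coeff_C a b c \<eta> p =
     a p * (partial_x \<eta> p)\<^sup>2 + 2 * b p * partial_x \<eta> p * partial_y \<eta> p + c p * (partial_y \<eta> p)\<^sup>2"
  for a b c \<eta> :: "plane \<Rightarrow> real"

definition reduces_at where
  "reduces_at a b c \<xi> \<eta> p \<longleftrightarrow>
     coeff_A a b c \<xi> p = coeff_C a b c \<eta> p \<and> coeff_B a b c \<xi> \<eta> p = 0"

definition sqrt_disc :: "(plane \<Rightarrow> real) \<Rightarrow> (plane \<Rightarrow> real) \<Rightarrow> (plane \<Rightarrow> real) \<Rightarrow> plane \<Rightarrow> real" where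
  "sqrt_disc a b c p = sqrt (a p * c p - (b p)\<^sup>2)"

definition q_coeff :: "(plane \<Rightarrow> real) \<Rightarrow> (plane \<Rightarrow> real) \<Rightarrow> (plane \<Rightarrow> real) \<Rightarrow> plane \<Rightarrow> complex" where
  "q_coeff a b c p =
     - ((of_real (a p) - of_real (sqrt_disc a b c p) + \<i> * of_real (b p))
        / (of_real (a p) + of_real (sqrt_disc a b c p) - \<i> * of_real (b p)))"

text \<open>Caution: the equation \<open>\<zeta>\<^sub>z\<^sub>b\<^sub>a\<^sub>r = q_pr \<zeta>\<^sub>z\<close> is invariant under \<open>\<zeta> \<mapsto> k \<zeta>\<close> for complex constants
  \<open>k\<close>, which multiplies \<open>A - C + 2 \<i> B\<close> by \<open>k\<^sup>2\<close>. So \<open>A \<noteq> C\<close> alone is meaningful only after the phase of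
  \<open>\<zeta>\<^sub>z\<close> is fixed: for \<open>a = 4\<close>, \<open>b = 0\<close>, \<open>c = 1\<close> we have \<open>q_pr = 1/3\<close>, and \<open>\<xi> = 4 x - 2 y\<close>,
  \<open>\<eta> = 4 x + 2 y\<close> solves the equation with \<open>A = C = 68\<close>, \<open>B = 60\<close>. The natural representative
  \<open>dz + q_pr dzbar\<close> has \<open>\<zeta>\<^sub>z = 1\<close>; a real \<open>\<zeta>\<^sub>z\<close> is the corresponding normalization.\<close>

definition q_pr :: "(plane \<Rightarrow> real) \<Rightarrow> (plane \<Rightarrow> real) \<Rightarrow> (plane \<Rightarrow> real) \<Rightarrow> plane \<Rightarrow> complex" where
  "q_pr a b c p =
     (of_real (a p) - of_real (sqrt_disc a b c p) - \<i> * of_real (b p))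
     / (of_real (a p) + of_real (sqrt_disc a b c p) + \<i> * of_real (b p))"

end

theory Submission imports Defs begin

text \<open>With \<open>W = \<zeta>\<^sub>z\<close>, \<open>V = \<zeta>\<^sub>z\<^sub>b\<^sub>a\<^sub>r\<close>, \<open>m = a - c + 2 \<i> b\<close> and \<open>s = a + c\<close> one has
  \<open>A - C + 2 \<i> B = a \<zeta>\<^sub>x\<^sup>2 + 2 b \<zeta>\<^sub>x \<zeta>\<^sub>y + c \<zeta>\<^sub>y\<^sup>2 = m W\<^sup>2 + 2 s W V + cnj m V\<^sup>2\<close>. If \<open>V = q W\<close> this is
  \<open>W\<^sup>2\<close> times a quadratic in \<open>q\<close>, and since \<open>\<bar>m\<bar>\<^sup>2 = (s - 2 \<delta>) (s + 2 \<delta>)\<close> for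
  \<open>\<delta> = \<surd>\<Delta>\<close>, that quadratic is \<open>((s + 2 \<delta>) q + m) (cnj m q + (s + 2 \<delta>)) / (s + 2 \<delta>)\<close>, whose
  second factor has no zero in the unit disc. The printed coefficient is \<open>cnj m / (s + 2 \<delta>)\<close>;
  there the real part of the quadratic is \<open>a - c\<close> times a positive number.\<close>

section \<open>Partial derivatives of a coordinate in terms of its total derivative\<close>

lemma has_derivative_imp_partial:
  assumes "(f has_derivative f') (at p)"
  shows "partial_x f p = f' (1, 0)" and "partial_y f p = f' (0, 1)"
proof -
  interpret f': bounded_linear f' using assms by (rule has_derivative_bounded_linear)
  \<comment> \<open>With \<open>p\<close> split into a pair, the chain rule applies along the
    horizontal and vertical lines through \<open>p\<close>.\<close>
  have f: "(f has_derivative f') (at (fst p, snd p))"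
    using assms by simp
  have "((\<lambda>t. f (t, snd p)) has_derivative (\<lambda>h. f' (h, 0))) (at (fst p))"
    by (rule has_derivative_compose[of "\<lambda>t. (t, snd p)" "\<lambda>h. (h, 0)" _ _ f f', OF _ f])
      (intro derivative_intros)
  moreover have "(\<lambda>h. f' (h, 0)) = (\<lambda>h. h *\<^sub>R f' (1, 0))"
    by (simp flip: f'.scaleR)
  ultimately have "((\<lambda>t. f (t, snd p)) has_vector_derivative f' (1, 0)) (at (fst p))"
    by (simp only: has_vector_derivative_def)
  then show "partial_x f p = f' (1, 0)"
    unfolding partial_x_def by (rule vector_derivative_at)
  have "((\<lambda>t. f (fst p, t)) has_derivative (\<lambda>h. f' (0, h))) (at (snd p))"
    by (rule has_derivative_compose[of "\<lambda>t. (fst p, t)" "\<lambda>h. (0, h)" _ _ f f', OF _ f])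
      (intro derivative_intros)
  moreover have "(\<lambda>h. f' (0, h)) = (\<lambda>h. h *\<^sub>R f' (0, 1))"
    by (simp flip: f'.scaleR)
  ultimately have "((\<lambda>t. f (fst p, t)) has_vector_derivative f' (0, 1)) (at (snd p))"
    by (simp only: has_vector_derivative_def)
  then show "partial_y f p = f' (0, 1)"
    unfolding partial_y_def by (rule vector_derivative_at)
qed

lemma has_derivative_zeta:
  assumes "(\<xi> has_derivative \<xi>') (at p)" and "(\<eta> has_derivative \<eta>') (at p)"
  shows "(zeta \<xi> \<eta> has_derivative zeta \<xi>' \<eta>') (at p)"
  unfolding zeta_def[abs_def] by (intro derivative_intros assms)

lemma partial_zeta:
  assumes "\<xi> differentiable (at p)" and "\<eta> differentiable (at p)"
  shows "partial_x (zeta \<xi> \<eta>) p = Complex (partial_x \<xi> p) (partial_x \<eta> p)"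
    and "partial_y (zeta \<xi> \<eta>) p = Complex (partial_y \<xi> p) (partial_y \<eta> p)"
proof -
  obtain \<xi>' \<eta>' where d: "(\<xi> has_derivative \<xi>') (at p)" "(\<eta> has_derivative \<eta>') (at p)"
    using assms unfolding differentiable_def by blast
  note partials = d[THEN has_derivative_imp_partial(1)] d[THEN has_derivative_imp_partial(2)]
    has_derivative_imp_partial[OF has_derivative_zeta[OF d]]
  show "partial_x (zeta \<xi> \<eta>) p = Complex (partial_x \<xi> p) (partial_x \<eta> p)"
    and "partial_y (zeta \<xi> \<eta>) p = Complex (partial_y \<xi> p) (partial_y \<eta> p)"
    unfolding partials by (simp_all add: zeta_def Complex_eq)
qed

text \<open>A linear map on the plane is determined by its values on the two basis vectors, and here
  these values are the partials.\<close>

lemma coordinate_at_partial_nonzero: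
  assumes "coordinate_at \<xi> \<eta> p"
  shows "partial_x (zeta \<xi> \<eta>) p \<noteq> 0 \<or> partial_y (zeta \<xi> \<eta>) p \<noteq> 0"
proof (rule ccontr)
  assume "\<not> ?thesis"
  then have 0: "partial_x (zeta \<xi> \<eta>) p = 0" "partial_y (zeta \<xi> \<eta>) p = 0"
    by auto
  let ?F = "frechet_derivative (zeta \<xi> \<eta>) (at p)"
  have "zeta \<xi> \<eta> differentiable (at p)"
    using assms has_derivative_zeta unfolding coordinate_at_def differentiable_def by blast
  then have F: "(zeta \<xi> \<eta> has_derivative ?F) (at p)"
    by (simp add: frechet_derivative_works)
  then interpret F: bounded_linear ?F by (rule has_derivative_bounded_linear)
  have "?F h = 0" for h
  proof -
    have "h = fst h *\<^sub>R (1, 0) + snd h *\<^sub>R (0, 1)"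
      by (simp add: prod_eq_iff)
    then have "?F h = ?F (fst h *\<^sub>R (1, 0) + snd h *\<^sub>R (0, 1))"
      by (rule arg_cong)
    also have "\<dots> = fst h *\<^sub>R ?F (1, 0) + snd h *\<^sub>R ?F (0, 1)"
      by (simp only: F.add F.scaleR)
    finally have "?F h = fst h *\<^sub>R ?F (1, 0) + snd h *\<^sub>R ?F (0, 1)" .
    then show ?thesis
      using 0 by (simp add: has_derivative_imp_partial[OF F])
  qed
  then show False
    using assms unfolding coordinate_at_def by blast
qed

section \<open>Wirtinger derivatives and the Beltrami equation at a point\<close>

lemma partial_eq_wirtinger:
  "partial_x \<zeta> p = wirtinger_z \<zeta> p + wirtinger_zbar \<zeta> p"
  "partial_y \<zeta> p = \<i> * (wirtinger_z \<zeta> p - wirtinger_zbar \<zeta> p)"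
  by (simp_all add: wirtinger_z_def wirtinger_zbar_def field_simps)

text \<open>If \<open>zeta_z\<close> vanished, the Beltrami equation would make
  \<open>zeta_zbar\<close> vanish too, and with them both partials.\<close>

lemma wirtinger_z_nonzero:
  assumes "coordinate_at \<xi> \<eta> p"
    and "wirtinger_zbar (zeta \<xi> \<eta>) p = q * wirtinger_z (zeta \<xi> \<eta>) p"
  shows "wirtinger_z (zeta \<xi> \<eta>) p \<noteq> 0"
  using coordinate_at_partial_nonzero[OF assms(1)] assms(2)
  by (auto simp: partial_eq_wirtinger)

text \<open>Supplies a test coordinate for every \<open>q\<close>, so that a condition on all
  solutions of the Beltrami equation yields a condition on \<open>q\<close> itself.\<close>

lemma exists_coordinate_with_wirtinger:
  obtains \<xi> \<eta> where "coordinate_at \<xi> \<eta> p"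
    and "wirtinger_z (zeta \<xi> \<eta>) p = 1" and "wirtinger_zbar (zeta \<xi> \<eta>) p = q"
proof
  \<comment> \<open>This is \<open>z + q * cnj z\<close>. It is real-linear, so it and its two
    components are their own derivatives.\<close>
  define f where "f = (\<lambda>h :: plane. Complex (fst h) (snd h) + q * Complex (fst h) (- snd h))"
  define \<xi> where "\<xi> = (\<lambda>h. Re (f h))"
  define \<eta> where "\<eta> = (\<lambda>h. Im (f h))"
  have \<xi>: "(\<xi> has_derivative \<xi>) (at p)" and \<eta>: "(\<eta> has_derivative \<eta>) (at p)"
    unfolding \<xi>_def \<eta>_def f_def by (auto intro!: derivative_eq_intros)
  have zeta: "zeta \<xi> \<eta> = f"
    by (simp add: fun_eq_iff zeta_def \<xi>_def \<eta>_def complex_eq_iff)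
  have f: "(f has_derivative f) (at p)"
    using has_derivative_zeta[OF \<xi> \<eta>] zeta by simp
  have partial: "partial_x f p = 1 + q" "partial_y f p = \<i> * (1 - q)"
    unfolding has_derivative_imp_partial[OF f] by (auto simp: f_def complex_eq_iff)
  show "wirtinger_z (zeta \<xi> \<eta>) p = 1" "wirtinger_zbar (zeta \<xi> \<eta>) p = q"
    by (simp_all add: zeta wirtinger_z_def wirtinger_zbar_def partial algebra_simps)
  have "f \<noteq> (\<lambda>h. 0)"
  proof
    assume "f = (\<lambda>h. 0)"
    then have "f (1, 0) = 0" and "f (0, 1) = 0"
      by simp_all
    then have "1 + q = 0" and "1 - q = 0"
      using partial unfolding has_derivative_imp_partial[OF f] by simp_all
    then have "(1 + q) + (1 - q) = 0"
      using add.right_neutral by metis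
    then show False by simp
  qed
  then show "coordinate_at \<xi> \<eta> p"
    using \<xi> \<eta> frechet_derivative_at[OF f] zeta
    unfolding coordinate_at_def differentiable_def by metis
qed

section \<open>The reduction condition as a quadratic equation in the Beltrami coefficient\<close>

lemma coeff_combination:
  assumes "\<xi> differentiable (at p)" and "\<eta> differentiable (at p)"
  shows "Complex (coeff_A a b c \<xi> p - coeff_C a b c \<eta> p) (2 * coeff_B a b c \<xi> \<eta> p) =
    of_real (a p) * (partial_x (zeta \<xi> \<eta>) p)\<^sup>2
    + 2 * of_real (b p) * partial_x (zeta \<xi> \<eta>) p * partial_y (zeta \<xi> \<eta>) p
    + of_real (c p) * (partial_y (zeta \<xi> \<eta>) p)\<^sup>2"
  by (simp add: partial_zeta[OF assms] coeff_A_def coeff_B_def coeff_C_def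
      complex_eq_iff power2_eq_square algebra_simps)

text \<open>The form \<open>a X^2 + 2 b X Y + c Y^2\<close> at \<open>X = 1 + q\<close>,
  \<open>Y = \<i> (1 - q)\<close>, the partials of a solution with
  \<open>zeta_z = 1\<close>.\<close>

definition beltrami_quadratic :: "real \<Rightarrow> real \<Rightarrow> real \<Rightarrow> complex \<Rightarrow> complex" where
  "beltrami_quadratic a b c q =
     Complex (a - c) (2 * b) + 2 * of_real (a + c) * q + Complex (a - c) (- 2 * b) * q\<^sup>2"

text \<open>Both partials are multiples of \<open>zeta_z\<close>, so homogeneity of degree two pulls
  out its square.\<close>

lemma coeff_combination_beltrami:
  assumes "coordinate_at \<xi> \<eta> p"
    and "wirtinger_zbar (zeta \<xi> \<eta>) p = q * wirtinger_z (zeta \<xi> \<eta>) p"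
  shows "Complex (coeff_A a b c \<xi> p - coeff_C a b c \<eta> p) (2 * coeff_B a b c \<xi> \<eta> p) =
    (wirtinger_z (zeta \<xi> \<eta>) p)\<^sup>2 * beltrami_quadratic (a p) (b p) (c p) q"
proof -
  define W where "W = wirtinger_z (zeta \<xi> \<eta>) p"
  have "of_real (a p) * (W + q * W)\<^sup>2 + 2 * of_real (b p) * (W + q * W) * (\<i> * (W - q * W))
      + of_real (c p) * (\<i> * (W - q * W))\<^sup>2 = W\<^sup>2 * beltrami_quadratic (a p) (b p) (c p) q"
    unfolding beltrami_quadratic_def Complex_eq
    by (simp add: power2_eq_square algebra_simps)
  then show ?thesis
    using assms unfolding coordinate_at_def
    by (simp add: coeff_combination partial_eq_wirtinger W_def)
qed

lemma reduces_at_iff_combination: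
  "reduces_at a b c \<xi> \<eta> p \<longleftrightarrow>
     Complex (coeff_A a b c \<xi> p - coeff_C a b c \<eta> p) (2 * coeff_B a b c \<xi> \<eta> p) = 0"
  by (auto simp: reduces_at_def complex_eq_iff)

lemma reduces_at_iff_beltrami:
  assumes "coordinate_at \<xi> \<eta> p"
    and "wirtinger_zbar (zeta \<xi> \<eta>) p = q * wirtinger_z (zeta \<xi> \<eta>) p"
  shows "reduces_at a b c \<xi> \<eta> p \<longleftrightarrow> beltrami_quadratic (a p) (b p) (c p) q = 0"
  using wirtinger_z_nonzero[OF assms]
  by (simp add: reduces_at_iff_combination coeff_combination_beltrami[OF assms])

section \<open>Algebra of the coefficients at a single point\<close>

text \<open>Here \<open>d\<close> stands for the root of the discriminant at a fixed point.
  Characterizing it by its sign and square keeps the algebra polynomial.\<close>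

locale elliptic_coefficients =
  fixes a b c d :: real
  assumes a_pos: "a > 0" and d_pos: "d > 0" and d_square: "d\<^sup>2 = a * c - b\<^sup>2"
begin

lemma c_pos: "c > 0"
proof -
  have "a * c > 0"
    using d_square d_pos by (smt (verit) zero_less_power zero_le_power2)
  then show ?thesis
    using a_pos by (simp add: zero_less_mult_iff)
qed

lemma trace_pos: "a + c + 2 * d > 0"
  using a_pos c_pos d_pos by simp

lemma modulus_square: "(a - c)\<^sup>2 + (2 * b)\<^sup>2 = (a + c + 2 * d) * (a + c - 2 * d)"
  using d_square by (simp add: power2_eq_square algebra_simps)

text \<open>The squared norm has factors \<open>a + c + 2 * d\<close> and
  \<open>a + c - 2 * d\<close>, and \<open>d > 0\<close> makes the second the smaller. This bound
  puts one root of the quadratic inside the unit disc and excludes any other there.\<close>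

lemma norm_less_trace: "norm (Complex (a - c) (2 * b)) < a + c + 2 * d"
proof -
  have "(norm (Complex (a - c) (2 * b)))\<^sup>2 = (a + c + 2 * d) * (a + c - 2 * d)"
    unfolding cmod_power2 by (simp only: complex.sel modulus_square)
  also have "\<dots> < (a + c + 2 * d)\<^sup>2"
    unfolding power2_eq_square using trace_pos d_pos by (intro mult_strict_left_mono) auto
  finally have "(norm (Complex (a - c) (2 * b)))\<^sup>2 < (a + c + 2 * d)\<^sup>2" .
  then show ?thesis
    by (rule power2_less_imp_less) (rule less_imp_le[OF trace_pos])
qed

lemma beltrami_quadratic_factor:
  "of_real (a + c + 2 * d) * beltrami_quadratic a b c q =
    (of_real (a + c + 2 * d) * q + Complex (a - c) (2 * b))
    * (Complex (a - c) (- 2 * b) * q + of_real (a + c + 2 * d))"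
proof -
  define T where "T = complex_of_real (a + c + 2 * d)"
  define m where "m = Complex (a - c) (2 * b)"
  define m' where "m' = Complex (a - c) (- 2 * b)"
  have "m * m' = of_real ((a - c)\<^sup>2 + (2 * b)\<^sup>2)"
    by (simp add: m_def m'_def complex_eq_iff power2_eq_square)
  \<comment> \<open>The coefficient of \<open>q\<close> in the expanded product; \<open>T\<close>
    divides \<open>m * m'\<close> by \<open>modulus_square\<close>.\<close>
  then have mm: "T * T + m * m' = T * (2 * of_real (a + c))"
    unfolding modulus_square T_def by (simp add: algebra_simps)
  have "(T * q + m) * (m' * q + T) = T * m' * q\<^sup>2 + (T * T + m * m') * q + T * m"
    by (simp add: power2_eq_square algebra_simps)
  then show ?thesis
    unfolding mm beltrami_quadratic_def T_def[symmetric] m_def[symmetric] m'_def[symmetric]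
    by (simp add: algebra_simps)
qed

text \<open>For \<open>q\<close> in the disc the second factor cannot vanish, its term in
  \<open>q\<close> being smaller in norm than its constant term; the first factor gives the
  root.\<close>

lemma beltrami_quadratic_zero_iff:
  assumes "norm q < 1"
  shows "beltrami_quadratic a b c q = 0 \<longleftrightarrow>
    q = - Complex (a - c) (2 * b) / of_real (a + c + 2 * d)"
proof -
  have T: "complex_of_real (a + c + 2 * d) \<noteq> 0"
    using trace_pos by (metis less_irrefl of_real_eq_0_iff)
  have "norm (Complex (a - c) (- 2 * b) * q) = norm (Complex (a - c) (2 * b)) * norm q"
    by (simp add: norm_mult complex_norm)
  also have "\<dots> \<le> norm (Complex (a - c) (2 * b))"
    using assms by (intro mult_left_le) auto
  also have "\<dots> < norm (- complex_of_real (a + c + 2 * d))"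
    using norm_less_trace by (simp del: of_real_add of_real_mult)
  finally have "Complex (a - c) (- 2 * b) * q \<noteq> - complex_of_real (a + c + 2 * d)"
    by (metis less_irrefl)
  then have "Complex (a - c) (- 2 * b) * q + of_real (a + c + 2 * d) \<noteq> 0"
    by (metis eq_neg_iff_add_eq_0)
  then have "beltrami_quadratic a b c q = 0 \<longleftrightarrow>
      of_real (a + c + 2 * d) * q + Complex (a - c) (2 * b) = 0"
    using beltrami_quadratic_factor[of q] T by (metis mult_eq_0_iff)
  also have "\<dots> \<longleftrightarrow> q = - Complex (a - c) (2 * b) / of_real (a + c + 2 * d)"
    using T by (metis eq_divide_eq eq_neg_iff_add_eq_0 mult.commute)
  finally show ?thesis .
qed

lemma norm_coefficient_less_1:
  "norm (- Complex (a - c) (2 * b) / of_real (a + c + 2 * d)) < 1"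
  using norm_less_trace trace_pos
  by (simp add: norm_divide divide_less_eq del: of_real_add of_real_mult)

lemma coefficient_alt:
  "- ((of_real a - of_real d + \<i> * of_real b) / (of_real a + of_real d - \<i> * of_real b)) =
    - Complex (a - c) (2 * b) / of_real (a + c + 2 * d)"
proof -
  have "complex_of_real (a + c + 2 * d) \<noteq> 0"
    using trace_pos by (metis less_irrefl of_real_eq_0_iff)
  moreover have "complex_of_real a + of_real d - \<i> * of_real b \<noteq> 0"
    using a_pos d_pos by (simp add: complex_eq_iff)
  moreover have "(complex_of_real a - of_real d + \<i> * of_real b) * of_real (a + c + 2 * d) =
      Complex (a - c) (2 * b) * (of_real a + of_real d - \<i> * of_real b)"
    using d_square by (simp add: complex_eq_iff power2_eq_square algebra_simps)
  ultimately show ?thesis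
    by (simp add: frac_eq_eq del: of_real_add of_real_mult)
qed

text \<open>The printed coefficient is minus the conjugate of the correct one, so the previous
  identity is conjugated.\<close>

lemma printed_coefficient_alt:
  "(of_real a - of_real d - \<i> * of_real b) / (of_real a + of_real d + \<i> * of_real b) =
    Complex (a - c) (- 2 * b) / of_real (a + c + 2 * d)"
  using arg_cong[OF coefficient_alt, of "\<lambda>z. - cnj z"] by (simp add: complex_cnj)

lemma Re_beltrami_quadratic_printed:
  assumes "a \<noteq> c"
  shows "Re (beltrami_quadratic a b c (Complex (a - c) (- 2 * b) / of_real (a + c + 2 * d))) \<noteq> 0"
proof -
  define T where "T = a + c + 2 * d"
  have T: "T > 0" unfolding T_def by (rule trace_pos)
  define u where "u = a - c"
  \<comment> \<open>The cofactor of \<open>u / T^2\<close> in the real part; its last two terms come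
    from the real part of \<open>(u - 2 \<i> b)^3\<close>.\<close>
  define k where "k = T\<^sup>2 + 2 * (a + c) * T + u\<^sup>2 - 3 * (2 * b)\<^sup>2"
  have "u\<^sup>2 + (2 * b)\<^sup>2 = T * (a + c - 2 * d)"
    unfolding u_def T_def by (rule modulus_square)
  \<comment> \<open>Eliminating \<open>b\<close> by the modulus identity removes the negative term
    and makes positivity visible.\<close>
  then have "k = T * (8 * d) + 4 * u\<^sup>2"
    unfolding k_def by (simp add: T_def power2_eq_square algebra_simps)
  moreover have "T * (8 * d) > 0"
    using T d_pos by simp
  ultimately have k: "k > 0"
    by (smt (verit) zero_le_power2)
  have q: "Complex u (- 2 * b) / of_real T = Complex (u / T) (- 2 * b / T)"
    using T by (simp add: complex_eq_iff)
  have "Re (beltrami_quadratic a b c (Complex u (- 2 * b) / of_real T)) = u * k / T\<^sup>2"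
    unfolding q beltrami_quadratic_def u_def[symmetric] k_def using T
    by (simp add: power2_eq_square field_simps)
  then show ?thesis
    using assms k T unfolding u_def T_def by simp
qed

end

section \<open>Assembling the claims at each point of the domain\<close>

theorem proposition4:
  fixes a b c :: "plane \<Rightarrow> real" and D :: "plane set"
  assumes a_pos: "\<And>p. p \<in> D \<Longrightarrow> a p > 0"
    and elliptic: "\<And>p. p \<in> D \<Longrightarrow> a p * c p - (b p)\<^sup>2 > 0"
  shows
    "(\<forall>p\<in>D. \<forall>\<xi> \<eta>. coordinate_at \<xi> \<eta> p \<longrightarrow>
        (reduces_at a b c \<xi> \<eta> p \<longleftrightarrow>
          of_real (a p) * (partial_x (zeta \<xi> \<eta>) p)\<^sup>2
          + 2 * of_real (b p) * partial_x (zeta \<xi> \<eta>) p * partial_y (zeta \<xi> \<eta>) p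
          + of_real (c p) * (partial_y (zeta \<xi> \<eta>) p)\<^sup>2 = 0))
   \<and> (\<forall>p\<in>D. \<forall>q :: complex.
        (norm q < 1 \<and>
         (\<forall>\<xi> \<eta>. coordinate_at \<xi> \<eta> p \<and>
            wirtinger_zbar (zeta \<xi> \<eta>) p = q * wirtinger_z (zeta \<xi> \<eta>) p
            \<longrightarrow> reduces_at a b c \<xi> \<eta> p))
        \<longleftrightarrow> q = q_coeff a b c p)
   \<and> (\<forall>p\<in>D. q_coeff a b c p =
        (of_real (c p) - of_real (a p) - 2 * \<i> * of_real (b p))
        / (of_real (a p) + of_real (c p) + 2 * of_real (sqrt_disc a b c p)))
   \<and> (\<forall>p\<in>D. q_pr a b c p = q_coeff a b c p \<longrightarrow> a p = c p)
   \<and> (\<forall>p\<in>D. a p \<noteq> c p \<longrightarrow>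
        (\<forall>\<xi> \<eta>. coordinate_at \<xi> \<eta> p \<and>
           wirtinger_zbar (zeta \<xi> \<eta>) p - q_pr a b c p * wirtinger_z (zeta \<xi> \<eta>) p = 0
           \<longrightarrow> (wirtinger_z (zeta \<xi> \<eta>) p \<in> \<real> \<longrightarrow> coeff_A a b c \<xi> p \<noteq> coeff_C a b c \<eta> p)
             \<and> \<not> reduces_at a b c \<xi> \<eta> p))"
proof -
  have elliptic_at: "elliptic_coefficients (a p) (b p) (c p) (sqrt_disc a b c p)" if "p \<in> D" for p
    using a_pos[OF that] elliptic[OF that] by unfold_locales (simp_all add: sqrt_disc_def)
  define q0 where "q0 p = - Complex (a p - c p) (2 * b p)
      / of_real (a p + c p + 2 * sqrt_disc a b c p)" for p
  have q_coeff: "q_coeff a b c p = q0 p" if "p \<in> D" for p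
    unfolding q_coeff_def q0_def by (rule elliptic_coefficients.coefficient_alt[OF elliptic_at[OF that]])
  have q_pr: "q_pr a b c p = Complex (a p - c p) (- 2 * b p)
      / of_real (a p + c p + 2 * sqrt_disc a b c p)" if "p \<in> D" for p
    unfolding q_pr_def
    by (rule elliptic_coefficients.printed_coefficient_alt[OF elliptic_at[OF that]])
  have "reduces_at a b c \<xi> \<eta> p \<longleftrightarrow>
      of_real (a p) * (partial_x (zeta \<xi> \<eta>) p)\<^sup>2
      + 2 * of_real (b p) * partial_x (zeta \<xi> \<eta>) p * partial_y (zeta \<xi> \<eta>) p
      + of_real (c p) * (partial_y (zeta \<xi> \<eta>) p)\<^sup>2 = 0"
    if "coordinate_at \<xi> \<eta> p" for p \<xi> \<eta>
    using that unfolding reduces_at_iff_combination coordinate_at_def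
    by (simp add: coeff_combination)
  moreover have "(norm q < 1 \<and>
      (\<forall>\<xi> \<eta>. coordinate_at \<xi> \<eta> p \<and>
         wirtinger_zbar (zeta \<xi> \<eta>) p = q * wirtinger_z (zeta \<xi> \<eta>) p
         \<longrightarrow> reduces_at a b c \<xi> \<eta> p))
      \<longleftrightarrow> q = q_coeff a b c p" (is "?L q \<longleftrightarrow> _") if p: "p \<in> D" for p q
  proof -
    interpret elliptic_coefficients "a p" "b p" "c p" "sqrt_disc a b c p"
      by (rule elliptic_at[OF p])
    obtain \<xi> \<eta> where co: "coordinate_at \<xi> \<eta> p"
      "wirtinger_z (zeta \<xi> \<eta>) p = 1" "wirtinger_zbar (zeta \<xi> \<eta>) p = q"
      by (rule exists_coordinate_with_wirtinger)
    \<comment> \<open>The test coordinate gives the forward direction; conversely, a zero of the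
      quadratic forces reduction for every solution.\<close>
    have "?L q \<longleftrightarrow> norm q < 1 \<and> beltrami_quadratic (a p) (b p) (c p) q = 0"
      using reduces_at_iff_beltrami[of _ _ p q] co by (metis mult.right_neutral)
    also have "\<dots> \<longleftrightarrow> q = q0 p"
      using beltrami_quadratic_zero_iff norm_coefficient_less_1 unfolding q0_def by metis
    finally show ?thesis
      by (simp only: q_coeff[OF p])
  qed
  moreover have "q_coeff a b c p =
      (of_real (c p) - of_real (a p) - 2 * \<i> * of_real (b p))
      / (of_real (a p) + of_real (c p) + 2 * of_real (sqrt_disc a b c p))" if "p \<in> D" for p
    unfolding q_coeff[OF that] q0_def by (simp add: Complex_eq)
  moreover have "a p = c p" if p: "p \<in> D" and eq: "q_pr a b c p = q_coeff a b c p" for p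
  proof -
    have "a p + c p + 2 * sqrt_disc a b c p > 0"
      by (rule elliptic_coefficients.trace_pos[OF elliptic_at[OF p]])
    then have "complex_of_real (a p + c p + 2 * sqrt_disc a b c p) \<noteq> 0"
      by (metis less_irrefl of_real_eq_0_iff)
    \<comment> \<open>Both closed forms share a nonzero denominator. The imaginary parts agree
      anyway, and the real parts force \<open>a p = c p\<close>.\<close>
    then have "Complex (a p - c p) (- 2 * b p) = - Complex (a p - c p) (2 * b p)"
      using eq unfolding q_pr[OF p] q_coeff[OF p] q0_def by (metis divide_cancel_right)
    then show ?thesis
      by (simp add: complex_eq_iff)
  qed
  moreover have "(wirtinger_z (zeta \<xi> \<eta>) p \<in> \<real> \<longrightarrow> coeff_A a b c \<xi> p \<noteq> coeff_C a b c \<eta> p)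
      \<and> \<not> reduces_at a b c \<xi> \<eta> p"
    if p: "p \<in> D" and ne: "a p \<noteq> c p" and co: "coordinate_at \<xi> \<eta> p"
      and "wirtinger_zbar (zeta \<xi> \<eta>) p - q_pr a b c p * wirtinger_z (zeta \<xi> \<eta>) p = 0" for p \<xi> \<eta>
  proof -
    have eq: "wirtinger_zbar (zeta \<xi> \<eta>) p = q_pr a b c p * wirtinger_z (zeta \<xi> \<eta>) p"
      using that by simp
    define Q where "Q = beltrami_quadratic (a p) (b p) (c p) (q_pr a b c p)"
    have Q: "Re Q \<noteq> 0"
      unfolding Q_def q_pr[OF p]
      by (rule elliptic_coefficients.Re_beltrami_quadratic_printed[OF elliptic_at[OF p] ne])
    have "coeff_A a b c \<xi> p \<noteq> coeff_C a b c \<eta> p" if real: "wirtinger_z (zeta \<xi> \<eta>) p \<in> \<real>"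
    proof -
      obtain w where w: "wirtinger_z (zeta \<xi> \<eta>) p = of_real w"
        using real by (rule Reals_cases)
      with wirtinger_z_nonzero[OF co eq] have "w \<noteq> 0" by simp
      \<comment> \<open>A real \<open>zeta_z\<close> has a positive square, which only rescales
        \<open>Re Q\<close>; a complex one could rotate \<open>Q\<close> onto the imaginary
        axis.\<close>
      have "coeff_A a b c \<xi> p - coeff_C a b c \<eta> p = Re ((of_real w)\<^sup>2 * Q)"
        using arg_cong[OF coeff_combination_beltrami[OF co eq], of Re]
        unfolding Q_def w by simp
      also have "\<dots> = w\<^sup>2 * Re Q"
        by (simp flip: of_real_power)
      finally show ?thesis
        using \<open>w \<noteq> 0\<close> Q by auto
    qed
    \<comment> \<open>Failure of reduction is independent of the phase of \<open>zeta_z\<close>,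
      since it only takes \<open>Q\<close> nonzero.\<close>
    moreover have "\<not> reduces_at a b c \<xi> \<eta> p"
      using reduces_at_iff_beltrami[OF co eq] Q unfolding Q_def by auto
    ultimately show ?thesis by blast
  qed
  ultimately show ?thesis by blast
qed

end
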